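(* For $\ell>0$ let $C_\ell$ be the round circle of circumference $\ell$ in $\mathbb R^2$, equipped with the Euclidean subspace metric. Then its magnitude is \[|C_\ell| = \left(\int_0^1\exp\left(-\tfrac{\ell}{\pi}\sin(\pi s)\right)\mathrm ds\right)^{-1}.\]
   Context: A weighting on a finite metric space $(W,d)$ is a choice of real number $w_x$ for each $x\in W$ such that $\sum_{x'\in W} e^{-d(x,x')}w_{x'}=1$ for every $x\in W$. If a weighting exists, the magnitude of $W$ is $|W| := \sum_{x\in W} w_x$; this is independent of the choice of weighting. A metric space $X$ is positive definite if for every finite subspace $W\subseteq X$ the matrix $(e^{-d(x,x')})_{x,x'\in W}$ is positive definite; subspaces of Euclidean space are positive definite, and finite positive definite spaces have a well-defined magnitude. The magnitude of a compact positive definite metric space $X$ is defined as $|X| := \sup\{|W| : W\subseteq X\text{ finite}\}$; equivalently (a result of Meckes), $|X|=\lim_{k}|X_k|$ for any sequence $(X_k)$ of finite subsets of $X$ converging to $X$ in the Hausdorff metric. In $C_\ell$ (radius $\ell/2\pi$), the distance between two points subtending an angle $\theta$ at the centre is $\frac{\ell}{\pi}\sin\frac{\theta}{2}$. *)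

theory Defs
  imports "HOL-Analysis.Analysis"
begin

text \<open>Metric spaces are rendered as subsets of a type of class \<open>metric_space\<close> with the induced
  metric.\<close>

definition weighting :: "'a::metric_space set \<Rightarrow> ('a \<Rightarrow> real) \<Rightarrow> bool" where
  "weighting W w \<longleftrightarrow> (\<forall>x\<in>W. (\<Sum>y\<in>W. exp (- dist x y) * w y) = 1)"

text \<open>The total weight does not depend on the choice of weighting, so the description below is
  meaningful whenever a weighting exists; it is only used for finite sets.\<close>

definition finite_magnitude :: "'a::metric_space set \<Rightarrow> real" where
  "finite_magnitude W = (THE m. \<exists>w. weighting W w \<and> m = (\<Sum>x\<in>W. w x))"

definition positive_definite_space :: "'a::metric_space set \<Rightarrow> bool" where
  "positive_definite_space X \<longleftrightarrow>
     (\<forall>W v. finite W \<longrightarrow> W \<subseteq> X \<longrightarrow> (\<exists>x\<in>W. v x \<noteq> 0) \<longrightarrow>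
        (\<Sum>x\<in>W. \<Sum>y\<in>W. v x * exp (- dist x y) * v y) > (0::real))"

text \<open>The supremum is taken in the extended reals, so an infinite magnitude is not confused with a
  real number. Magnitude is left unspecified outside the compact positive definite spaces;
  evaluating it for a given space therefore requires showing that the space is of this kind.\<close>

definition magnitude :: "'a::metric_space set \<Rightarrow> ereal" where
  "magnitude X =
     (if compact X \<and> positive_definite_space X
      then (SUP W\<in>{W. finite W \<and> W \<subseteq> X}. ereal (finite_magnitude W))
      else undefined)"

definition round_circle :: "real \<Rightarrow> (real^2) set" where
  "round_circle l = sphere 0 (l / (2 * pi))"

end

theory Submission
  imports Defs
begin

text \<open>Measure angles in turns. The chordal distance turns \<open>exp (- dist)\<close> into
  \<open>F s = exp (- a * sin (pi * s))\<close>, where \<open>s\<close> is the angle difference and \<open>a = l / pi\<close>. Since \<open>F\<close> is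
  convex on the unit interval and symmetric about \<open>1/2\<close>, it is a positive constant plus a mixture,
  with density \<open>F''\<close>, of the functions giving the overlap of two arcs of length \<open>t \<le> 1/2\<close>. Each
  overlap function has a nonnegative quadratic form, and for small \<open>t\<close> this form is diagonal; hence the
  circle is positive definite.

  A regular \<open>n\<close>-gon has a constant weighting, and its magnitude is the reciprocal of a Riemann sum,
  which gives the lower bound in the limit. For the upper bound, compare the weighting \<open>w\<close> of a finite
  set \<open>W\<close> with the weighting \<open>u\<close> of the \<open>n\<close>-gon: positivity on \<open>w - u\<close> gives
  \<open>2 \<langle>w, u\<rangle> \<le> |W| + \<langle>u, u\<rangle>\<close>, and \<open>\<langle>w, u\<rangle>\<close> tends to \<open>|W|\<close> because
  Riemann sums of a periodic function converge from every starting point.\<close>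

section \<open>Weightings on positive definite spaces\<close>

text \<open>Pair \<open>w\<close> with \<open>w'\<close> through the kernel: since the distance is
  symmetric, the double sum collapses to either total.\<close>

lemma weighting_total_unique:
  assumes "weighting W w" "weighting W w'"
  shows "(\<Sum>x\<in>W. w x) = (\<Sum>x\<in>W. w' x)"
proof -
  have "(\<Sum>x\<in>W. w x) = (\<Sum>x\<in>W. w x * (\<Sum>y\<in>W. exp (- dist x y) * w' y))"
    using assms(2) by (intro sum.cong) (auto simp: weighting_def)
  also have "\<dots> = (\<Sum>x\<in>W. \<Sum>y\<in>W. w x * (exp (- dist x y) * w' y))"
    by (simp add: sum_distrib_left)
  also have "\<dots> = (\<Sum>y\<in>W. \<Sum>x\<in>W. w x * (exp (- dist x y) * w' y))"
    by (rule sum.swap)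
  also have "\<dots> = (\<Sum>y\<in>W. w' y * (\<Sum>x\<in>W. exp (- dist y x) * w x))"
    by (simp add: sum_distrib_left dist_commute mult_ac)
  also have "\<dots> = (\<Sum>x\<in>W. w' x)"
    using assms(1) by (intro sum.cong) (auto simp: weighting_def)
  finally show ?thesis .
qed

lemma finite_magnitude_eq:
  assumes "weighting W w"
  shows "finite_magnitude W = (\<Sum>x\<in>W. w x)"
  unfolding finite_magnitude_def
  using assms by (blast intro: the_equality weighting_total_unique)

lemma positive_definite_space_quadratic_nonneg:
  fixes v :: "'a::metric_space \<Rightarrow> real"
  assumes "positive_definite_space X" "finite W" "W \<subseteq> X"
  shows "(\<Sum>x\<in>W. \<Sum>y\<in>W. v x * exp (- dist x y) * v y) \<ge> 0"
proof (cases "\<exists>x\<in>W. v x \<noteq> 0")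
  case True
  then show ?thesis using assms unfolding positive_definite_space_def by (meson less_imp_le)
qed simp

text \<open>Adding a point to \<open>W\<close> is a Schur complement step: the pivot \<open>1 - s\<close> is the value of the
  quadratic form at \<open>v\<close>.\<close>

lemma positive_definite_space_solvable:
  fixes b :: "'a::metric_space \<Rightarrow> real"
  assumes X: "positive_definite_space X" and "finite W" "W \<subseteq> X"
  shows "\<exists>w. \<forall>x\<in>W. (\<Sum>y\<in>W. exp (- dist x y) * w y) = b x"
  using assms(2,3)
proof (induction W arbitrary: b rule: finite_induct)
  case empty
  then show ?case by simp
next
  case (insert p W)
  obtain u where u: "\<And>x. x \<in> W \<Longrightarrow> (\<Sum>y\<in>W. exp (- dist x y) * u y) = exp (- dist x p)"
    using insert.IH[of "\<lambda>x. exp (- dist x p)"] insert.prems by auto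
  obtain w where w: "\<And>x. x \<in> W \<Longrightarrow> (\<Sum>y\<in>W. exp (- dist x y) * w y) = b x"
    using insert.IH[of b] insert.prems by auto
  \<comment> \<open>As \<open>u\<close> reproduces the column of \<open>p\<close> on
    \<open>W\<close>, the vector \<open>v\<close> (1 at \<open>p\<close>, \<open>- u\<close> on
    \<open>W\<close>) is annihilated by every row except that of \<open>p\<close>.\<close>
  define s where "s = (\<Sum>y\<in>W. exp (- dist p y) * u y)"
  define v where "v = (\<lambda>x. if x = p then 1 else - u x)"
  have ext: "(\<Sum>y\<in>insert p W. exp (- dist x y) * (if y = p then c else f y))
      = exp (- dist x p) * c + (\<Sum>y\<in>W. exp (- dist x y) * f y)" for x c and f :: "'a \<Rightarrow> real"
    using insert.hyps by (auto intro!: sum.cong)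
  have row: "(\<Sum>y\<in>insert p W. exp (- dist x y) * v y) = (if x = p then 1 - s else 0)"
    if "x \<in> insert p W" for x
    using that u insert.hyps(2) unfolding v_def ext by (auto simp: s_def sum_negf)
  have "0 < (\<Sum>x\<in>insert p W. \<Sum>y\<in>insert p W. v x * exp (- dist x y) * v y)"
    using insert.prems insert.hyps
    by (intro X[unfolded positive_definite_space_def, rule_format]) (auto simp: v_def)
  also have "\<dots> = (\<Sum>x\<in>insert p W. v x * (\<Sum>y\<in>insert p W. exp (- dist x y) * v y))"
    by (simp only: sum_distrib_left mult.assoc)
  also have "\<dots> = (\<Sum>x\<in>insert p W. v x * (if x = p then 1 - s else 0))"
    using row by (intro sum.cong) auto
  also have "\<dots> = 1 - s"
    using insert.hyps by (simp add: v_def if_distrib cong: if_cong)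
  finally have s: "1 - s > 0" .
  \<comment> \<open>Putting weight \<open>c\<close> at \<open>p\<close> and subtracting
    \<open>c * u\<close> from \<open>w\<close> leaves the rows of \<open>W\<close> correct for every
    \<open>c\<close>; the row of \<open>p\<close> then determines \<open>c\<close>.\<close>
  define c where "c = (b p - (\<Sum>y\<in>W. exp (- dist p y) * w y)) / (1 - s)"
  have c: "c * (1 - s) = b p - (\<Sum>y\<in>W. exp (- dist p y) * w y)"
    using s by (simp add: c_def)
  show ?case
  proof (intro exI ballI)
    fix x assume x: "x \<in> insert p W"
    have "(\<Sum>y\<in>W. exp (- dist x y) * (w y - c * u y))
      = (\<Sum>y\<in>W. exp (- dist x y) * w y) - c * (\<Sum>y\<in>W. exp (- dist x y) * u y)"
      by (simp add: right_diff_distrib sum_subtractf sum_distrib_left mult_ac)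
    then show "(\<Sum>y\<in>insert p W. exp (- dist x y) * (if y = p then c else w y - c * u y)) = b x"
      using x u w c unfolding ext by (auto simp: s_def algebra_simps)
  qed
qed

lemma positive_definite_space_weighting:
  assumes "positive_definite_space X" "finite W" "W \<subseteq> X"
  obtains w where "weighting W w"
  using positive_definite_space_solvable[OF assms, of "\<lambda>_. 1"] unfolding weighting_def by blast

text \<open>Expand the nonnegative form at \<open>w - u\<close>. The sets may overlap or differ, so
  both functions are first extended by zero to \<open>A \<union> B\<close>.\<close>

lemma positive_definite_space_cross_le:
  fixes w u :: "'a::metric_space \<Rightarrow> real"
  assumes X: "positive_definite_space X" and A: "finite A" "A \<subseteq> X" and B: "finite B" "B \<subseteq> X"
  shows "2 * (\<Sum>x\<in>A. \<Sum>y\<in>B. w x * exp (- dist x y) * u y)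
    \<le> (\<Sum>x\<in>A. \<Sum>y\<in>A. w x * exp (- dist x y) * w y)
      + (\<Sum>x\<in>B. \<Sum>y\<in>B. u x * exp (- dist x y) * u y)"
proof -
  define U where "U = A \<union> B"
  define w' where "w' = (\<lambda>x. if x \<in> A then w x else 0)"
  define u' where "u' = (\<lambda>x. if x \<in> B then u x else 0)"
  have restr: "(\<Sum>x\<in>U. \<Sum>y\<in>U. (if x \<in> C then f x else 0) * exp (- dist x y) * (if y \<in> D then h y else 0))
     = (\<Sum>x\<in>C. \<Sum>y\<in>D. f x * exp (- dist x y) * h y)"
    if "C \<subseteq> U" "D \<subseteq> U" for C D and f h :: "'a \<Rightarrow> real"
  proof -
    have fin: "finite U" using A B by (simp add: U_def)
    have "(\<Sum>x\<in>U. \<Sum>y\<in>U. (if x \<in> C then f x else 0) * exp (- dist x y) * (if y \<in> D then h y else 0))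
      = (\<Sum>x\<in>U. \<Sum>y\<in>D. (if x \<in> C then f x else 0) * exp (- dist x y) * h y)"
      using that fin by (intro sum.cong refl sum.mono_neutral_cong_right) auto
    also have "\<dots> = (\<Sum>x\<in>C. \<Sum>y\<in>D. f x * exp (- dist x y) * h y)"
      by (rule sum.mono_neutral_cong_right) (use that fin in auto)
    finally show ?thesis .
  qed
  have "0 \<le> (\<Sum>x\<in>U. \<Sum>y\<in>U. (w' x - u' x) * exp (- dist x y) * (w' y - u' y))"
    using A B by (intro positive_definite_space_quadratic_nonneg[OF X]) (auto simp: U_def)
  also have "\<dots> = (\<Sum>x\<in>U. \<Sum>y\<in>U. w' x * exp (- dist x y) * w' y)
      + (\<Sum>x\<in>U. \<Sum>y\<in>U. u' x * exp (- dist x y) * u' y)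
      - (\<Sum>x\<in>U. \<Sum>y\<in>U. w' x * exp (- dist x y) * u' y)
      - (\<Sum>x\<in>U. \<Sum>y\<in>U. u' x * exp (- dist x y) * w' y)"
    by (simp add: algebra_simps sum.distrib sum_subtractf)
  also have "(\<Sum>x\<in>U. \<Sum>y\<in>U. u' x * exp (- dist x y) * w' y)
      = (\<Sum>x\<in>U. \<Sum>y\<in>U. w' x * exp (- dist x y) * u' y)"
    by (subst sum.swap) (simp add: dist_commute mult_ac)
  finally show ?thesis
    unfolding w'_def u'_def using restr[of A A w w] restr[of B B u u] restr[of A B w u]
    by (simp add: U_def)
qed

section \<open>Strict positive definiteness of the circle\<close>

text \<open>For \<open>s\<close> in the unit interval and \<open>t\<close> at most
  \<open>1/2\<close> this is the overlap of two arcs of length \<open>t\<close> whose starting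
  points are \<open>s\<close> apart; the summands belong to the two ways round the circle.\<close>

definition tent :: "real \<Rightarrow> real \<Rightarrow> real" where
  "tent t s = max 0 (t - s) + max 0 (t - (1 - s))"

text \<open>Indicator of an arc of length \<open>t\<close> starting at \<open>x\<close> on the circle \<open>\<real>/\<int>\<close>; the two summands
  suffice for \<open>x\<close> and \<open>\<phi>\<close> in the unit interval and \<open>t \<le> 1/2\<close>.\<close>

definition arc_indicator :: "real \<Rightarrow> real \<Rightarrow> real \<Rightarrow> real" where
  "arc_indicator t x \<phi> = indicator {x..x + t} \<phi> + indicator {x - 1..x - 1 + t} \<phi>"

lemma has_integral_indicator_Icc_mult:
  fixes a b c d p q :: real
  assumes "p \<le> q"
  shows "((\<lambda>s. indicator {a..b} s * indicator {c..d} s) has_integral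
           max 0 (min (min b d) q - max (max a c) p)) {p..q}"
proof -
  define m where "m = max (max a c) p"
  define n where "n = min (min b d) q"
  have "((\<lambda>s. 1::real) has_integral max 0 (n - m)) {m..n}"
    using has_integral_const_real[of "1::real" m n] by (simp add: max_def)
  then have "((\<lambda>s. if s \<in> {m..n} then 1 else 0::real) has_integral max 0 (n - m)) {p..q}"
    by (subst has_integral_restrict) (auto simp: m_def n_def)
  then show ?thesis
    unfolding m_def n_def
    by (rule has_integral_eq[rotated]) (auto simp: indicator_def)
qed

lemma has_integral_arc_indicator_mult:
  assumes "0 \<le> x" "x < 1" "0 \<le> y" "y < 1" "0 \<le> t" "t \<le> 1 / 2"
  shows "((\<lambda>\<phi>. arc_indicator t x \<phi> * arc_indicator t y \<phi>) has_integral tent t \<bar>x - y\<bar>) {0..1}"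
proof -
  define L where "L = (\<lambda>a c. max 0 (min (min (a + t) (c + t)) 1 - max (max a c) 0))"
  have I: "((\<lambda>s. indicator {a..a + t} s * indicator {c..c + t} s) has_integral L a c) {0..1}"
    for a c :: real
    unfolding L_def by (rule has_integral_indicator_Icc_mult) simp
  have "((\<lambda>\<phi>. arc_indicator t x \<phi> * arc_indicator t y \<phi>) has_integral
      (L x y + L x (y - 1)) + (L (x - 1) y + L (x - 1) (y - 1))) {0..1}"
    unfolding arc_indicator_def distrib_left distrib_right
    using has_integral_add[OF has_integral_add[OF I[of x y] I[of x "y - 1"]]
        has_integral_add[OF I[of "x - 1" y] I[of "x - 1" "y - 1"]]]
    by (simp add: add_ac)
  moreover have "(L x y + L x (y - 1)) + (L (x - 1) y + L (x - 1) (y - 1)) = tent t \<bar>x - y\<bar>"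
  proof -
    \<comment> \<open>For \<open>p\<close> before \<open>q\<close>, the direct overlap is cut at 1
      into \<open>L p q\<close> and \<open>L (p - 1) (q - 1)\<close>, while
      \<open>L p (q - 1)\<close> is the overlap the other way round.\<close>
    have ordered: "(L p q + L p (q - 1)) + (L (p - 1) q + L (p - 1) (q - 1)) = tent t (q - p)"
      if "0 \<le> p" "p \<le> q" "q < 1" for p q
    proof -
      have "L p q = max 0 (min (p + t) 1 - q)" "L p (q - 1) = max 0 (q - 1 + t - p)"
        "L (p - 1) q = 0" "L (p - 1) (q - 1) = max 0 (p - 1 + t)"
        unfolding L_def using that assms by (auto simp: min_def max_def)
      then show ?thesis
        unfolding tent_def using that by (auto simp: min_def max_def)
    qed
    have sym: "L p q = L q p" for p q
      by (simp add: L_def min.commute max.commute)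
    show ?thesis
    proof (cases "x \<le> y")
      case True
      then show ?thesis using ordered[of x y] assms by (simp add: abs_minus_commute)
    next
      case False
      then show ?thesis
        using ordered[of y x] assms sym[of x y] sym[of x "y - 1"] sym[of "x - 1" y]
          sym[of "x - 1" "y - 1"] by simp
    qed
  qed
  ultimately show ?thesis by simp
qed

text \<open>The form is the integral of the square of the step function obtained by summing the arc
  indicators with coefficients \<open>v\<close>.\<close>

lemma tent_quadratic_nonneg:
  assumes A: "finite A" "A \<subseteq> {0..<1}" and t: "0 \<le> t" "t \<le> 1 / 2"
  shows "(\<Sum>x\<in>A. \<Sum>y\<in>A. v x * tent t \<bar>x - y\<bar> * v y) \<ge> 0"
proof -
  have "((\<lambda>\<phi>. \<Sum>x\<in>A. \<Sum>y\<in>A. v x * (arc_indicator t x \<phi> * arc_indicator t y \<phi>) * v y)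
      has_integral (\<Sum>x\<in>A. \<Sum>y\<in>A. v x * tent t \<bar>x - y\<bar> * v y)) {0..1}"
    using A t
    by (intro has_integral_sum has_integral_mult_left has_integral_mult_right
        has_integral_arc_indicator_mult) auto
  moreover have "(\<Sum>x\<in>A. \<Sum>y\<in>A. v x * (arc_indicator t x \<phi> * arc_indicator t y \<phi>) * v y)
      = (\<Sum>x\<in>A. v x * arc_indicator t x \<phi>)\<^sup>2" for \<phi>
    by (simp add: power2_eq_square sum_product mult_ac)
  ultimately show ?thesis
    by (metis (no_types, lifting) has_integral_nonneg zero_le_power2)
qed

text \<open>Once \<open>t\<close> is no larger than any circular distance between distinct points of
  \<open>A\<close>, the tent matrix is \<open>t\<close> times the identity. This is the source of
  strictness.\<close>

lemma tent_quadratic_eq_small: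
  assumes A: "finite A" "A \<subseteq> {0..<1}" and t: "0 \<le> t" "t \<le> 1 / 2"
    and sep: "\<And>x y. x \<in> A \<Longrightarrow> y \<in> A \<Longrightarrow> x \<noteq> y \<Longrightarrow> t \<le> \<bar>x - y\<bar> \<and> t \<le> 1 - \<bar>x - y\<bar>"
  shows "(\<Sum>x\<in>A. \<Sum>y\<in>A. v x * tent t \<bar>x - y\<bar> * v y) = t * (\<Sum>x\<in>A. (v x)\<^sup>2)"
proof -
  have "v x * tent t \<bar>x - y\<bar> * v y = (if y = x then t * (v x)\<^sup>2 else 0)"
    if "x \<in> A" "y \<in> A" for x y
    using sep[OF that] t by (auto simp: tent_def power2_eq_square)
  then have "(\<Sum>x\<in>A. \<Sum>y\<in>A. v x * tent t \<bar>x - y\<bar> * v y)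
      = (\<Sum>x\<in>A. \<Sum>y\<in>A. if y = x then t * (v x)\<^sup>2 else 0)"
    by (intro sum.cong) auto
  then show ?thesis using A by (simp add: sum_distrib_left)
qed

text \<open>The second derivative of \<open>\<lambda>s. exp (- a * sin (pi * s))\<close>.\<close>

definition chord_density :: "real \<Rightarrow> real \<Rightarrow> real" where
  "chord_density a t = pi\<^sup>2 * (a * sin (pi * t) + (a * cos (pi * t))\<^sup>2) * exp (- a * sin (pi * t))"

lemma chord_density_pos:
  assumes "a > 0" "0 < t" "t < 1"
  shows "chord_density a t > 0"
  unfolding chord_density_def using assms
  by (intro mult_pos_pos add_pos_nonneg) (auto intro!: sin_gt_zero)

lemma chord_density_nonneg:
  assumes "a > 0" "0 \<le> t" "t \<le> 1"
  shows "chord_density a t \<ge> 0"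
  unfolding chord_density_def using assms
  by (intro mult_nonneg_nonneg add_nonneg_nonneg) (auto intro!: sin_ge_zero)

lemma exp_sin_tent_integral_aux:
  assumes "0 \<le> s" "s \<le> 1 / 2"
  shows "((\<lambda>t. max 0 (t - s) * chord_density a t) has_integral
    exp (- a * sin (pi * s)) - exp (- a)) {0..1 / 2}"
proof -
  \<comment> \<open>Integration by parts: with \<open>F t = exp (- a * sin (pi * t))\<close>, this
    is \<open>(t - s) * F' t - F t\<close>, and \<open>F'\<close> vanishes at
    \<open>1/2\<close>.\<close>
  define G where "G = (\<lambda>t. - (t - s) * (a * pi * cos (pi * t) * exp (- a * sin (pi * t)))
    - exp (- a * sin (pi * t)))"
  have "((\<lambda>t. (t - s) * chord_density a t) has_integral G (1 / 2) - G s) {s..1 / 2}"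
  proof (rule fundamental_theorem_of_calculus)
    show "s \<le> 1 / 2" by fact
    show "(G has_vector_derivative (t - s) * chord_density a t) (at t within {s..1 / 2})" for t
      unfolding G_def chord_density_def has_real_derivative_iff_has_vector_derivative[symmetric]
      by (auto intro!: derivative_eq_intros simp: algebra_simps power2_eq_square)
  qed
  moreover have "G (1 / 2) - G s = exp (- a * sin (pi * s)) - exp (- a)"
    by (simp add: G_def)
  ultimately have "((\<lambda>t. if t \<in> {s..1 / 2} then (t - s) * chord_density a t else 0) has_integral
      exp (- a * sin (pi * s)) - exp (- a)) {0..1 / 2}"
    using assms by (subst has_integral_restrict) auto
  then show ?thesis
    by (rule has_integral_eq[rotated]) auto
qed

text \<open>Taylor's formula with integral remainder at \<open>1/2\<close>, where the first derivative vanishes.\<close>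

lemma exp_sin_tent_integral:
  assumes "0 \<le> s" "s \<le> 1"
  shows "((\<lambda>t. tent t s * chord_density a t) has_integral
    exp (- a * sin (pi * s)) - exp (- a)) {0..1 / 2}"
proof (cases "s \<le> 1 / 2")
  \<comment> \<open>For \<open>t\<close> at most \<open>1/2\<close> only the first summand of
    \<open>tent\<close> can be nonzero here; in the other case only the second, and reflecting
    \<open>s\<close> to \<open>1 - s\<close> exchanges them.\<close>
  case True
  then show ?thesis
    by (intro has_integral_eq[OF _ exp_sin_tent_integral_aux]) (use assms in \<open>auto simp: tent_def\<close>)
next
  case False
  have "sin (pi * (1 - s)) = sin (pi * s)"
    by (simp add: right_diff_distrib sin_diff)
  moreover have "((\<lambda>t. tent t s * chord_density a t) has_integral
      exp (- a * sin (pi * (1 - s))) - exp (- a)) {0..1 / 2}"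
    by (intro has_integral_eq[OF _ exp_sin_tent_integral_aux])
      (use assms False in \<open>auto simp: tent_def\<close>)
  ultimately show ?thesis by simp
qed

text \<open>The form splits into \<open>exp (- a)\<close> times a square and the integral
  \<open>J\<close> of tent forms against the density. The integrand of \<open>J\<close> is
  continuous, nonnegative and positive at a small \<open>t\<close>, so \<open>J\<close> is
  positive.\<close>

lemma exp_sin_quadratic_pos:
  fixes v :: "real \<Rightarrow> real"
  assumes a: "a > 0" and A: "finite A" "A \<subseteq> {0..<1}" and v: "\<exists>x\<in>A. v x \<noteq> 0"
  shows "(\<Sum>x\<in>A. \<Sum>y\<in>A. v x * exp (- a * sin (pi * \<bar>x - y\<bar>)) * v y) > 0"
proof -
  define Q where "Q = (\<lambda>t. \<Sum>x\<in>A. \<Sum>y\<in>A. v x * tent t \<bar>x - y\<bar> * v y)"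
  define J where "J = (\<Sum>x\<in>A. \<Sum>y\<in>A. v x * (exp (- a * sin (pi * \<bar>x - y\<bar>)) - exp (- a)) * v y)"
  have "\<bar>x - y\<bar> \<le> 1" if "x \<in> A" "y \<in> A" for x y
  proof -
    have "0 \<le> x" "x < 1" "0 \<le> y" "y < 1" using that A(2) by auto
    then show ?thesis by linarith
  qed
  then have "((\<lambda>t. \<Sum>x\<in>A. \<Sum>y\<in>A. v x * (tent t \<bar>x - y\<bar> * chord_density a t) * v y)
      has_integral J) {0..1 / 2}"
    unfolding J_def using A
    by (intro has_integral_sum has_integral_mult_left has_integral_mult_right
        exp_sin_tent_integral) auto
  moreover have "(\<Sum>x\<in>A. \<Sum>y\<in>A. v x * (tent t \<bar>x - y\<bar> * chord_density a t) * v y)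
      = Q t * chord_density a t" for t
    by (simp add: Q_def sum_distrib_left mult_ac)
  ultimately have int: "((\<lambda>t. Q t * chord_density a t) has_integral J) {0..1 / 2}"
    by simp
  have Q_nonneg: "Q t \<ge> 0" if "t \<in> {0..1 / 2}" for t
    unfolding Q_def using that A by (intro tent_quadratic_nonneg) auto
  have cont: "continuous_on {0..1 / 2} (\<lambda>t. Q t * chord_density a t)"
    unfolding Q_def tent_def chord_density_def by (intro continuous_intros)
  obtain t where t: "0 < t" "t \<le> 1 / 2"
    and sep: "\<And>x y. x \<in> A \<Longrightarrow> y \<in> A \<Longrightarrow> x \<noteq> y \<Longrightarrow> t \<le> \<bar>x - y\<bar> \<and> t \<le> 1 - \<bar>x - y\<bar>"
  proof
    \<comment> \<open>The circular distances between distinct points; inserting \<open>1/2\<close>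
      keeps the set nonempty for a singleton \<open>A\<close> and bounds its minimum.\<close>
    define D where "D = insert (1 / 2) ((\<lambda>(x, y). min \<bar>x - y\<bar> (1 - \<bar>x - y\<bar>)) `
      {(x, y) \<in> A \<times> A. x \<noteq> y})"
    have "finite {(x, y) \<in> A \<times> A. x \<noteq> y}"
      by (rule finite_subset[of _ "A \<times> A"]) (use A in auto)
    then have fin: "finite D" by (simp add: D_def)
    have "d > 0" if "d \<in> D" for d
    proof -
      have "\<bar>x - y\<bar> > 0 \<and> \<bar>x - y\<bar> < 1" if "x \<in> A" "y \<in> A" "x \<noteq> y" for x y
      proof -
        have "0 \<le> x" "x < 1" "0 \<le> y" "y < 1" using that A(2) by auto
        then show ?thesis using that by linarith
      qed
      then show ?thesis using \<open>d \<in> D\<close> by (auto simp: D_def)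
    qed
    then show "0 < Min D" using fin by (subst Min_gr_iff) (auto simp: D_def)
    show "Min D \<le> 1 / 2" using fin by (intro Min_le) (auto simp: D_def)
    show "Min D \<le> \<bar>x - y\<bar> \<and> Min D \<le> 1 - \<bar>x - y\<bar>" if "x \<in> A" "y \<in> A" "x \<noteq> y" for x y
    proof -
      have "Min D \<le> min \<bar>x - y\<bar> (1 - \<bar>x - y\<bar>)"
        using fin that by (intro Min_le) (force simp: D_def)+
      then show ?thesis by simp
    qed
  qed
  have "(\<Sum>x\<in>A. (v x)\<^sup>2) > 0"
    using v A by (metis sum_pos2 zero_le_power2 zero_less_power2)
  then have "Q t > 0"
    unfolding Q_def using t sep A by (subst tent_quadratic_eq_small) auto
  then have pos: "Q t * chord_density a t > 0"
    using t a chord_density_pos[of a t] by simp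
  have nonneg: "Q t * chord_density a t \<ge> 0" if "t \<in> {0..1 / 2}" for t
    using Q_nonneg[OF that] chord_density_nonneg[of a t] a that by auto
  have "J \<ge> 0"
    using has_integral_nonneg[OF int nonneg] .
  moreover have "J \<noteq> 0"
  proof
    assume "J = 0"
    then have "Q t * chord_density a t = 0"
      using int t cont nonneg
      by (intro has_integral_0_cbox_imp_0[of 0 "1 / 2" "\<lambda>t. Q t * chord_density a t" t]) auto
    then show False using pos by linarith
  qed
  moreover have "(\<Sum>x\<in>A. \<Sum>y\<in>A. v x * exp (- a * sin (pi * \<bar>x - y\<bar>)) * v y)
      = J + exp (- a) * (\<Sum>x\<in>A. v x)\<^sup>2"
    by (simp add: J_def power2_eq_square sum_product sum_distrib_left algebra_simps
        sum.distrib sum_subtractf)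
  moreover have "exp (- a) * (\<Sum>x\<in>A. v x)\<^sup>2 \<ge> 0" by simp
  ultimately show ?thesis by linarith
qed

section \<open>Parametrization of the circle by turns\<close>

definition circle_point :: "real \<Rightarrow> real \<Rightarrow> real^2" where
  "circle_point l u = vector [l / (2 * pi) * cos (2 * pi * u), l / (2 * pi) * sin (2 * pi * u)]"

text \<open>Law of cosines followed by the half-angle formula. The absolute value makes the formula
  valid for all real parameters.\<close>

lemma dist_circle_point:
  assumes "l > 0"
  shows "dist (circle_point l u) (circle_point l w) = l / pi * \<bar>sin (pi * (u - w))\<bar>"
proof -
  define r where "r = l / (2 * pi)"
  have r: "r > 0" using assms by (simp add: r_def)
  have "(r * cos (2 * pi * u) - r * cos (2 * pi * w))\<^sup>2 + (r * sin (2 * pi * u) - r * sin (2 * pi * w))\<^sup>2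
      = r\<^sup>2 * (((sin (2 * pi * u))\<^sup>2 + (cos (2 * pi * u))\<^sup>2) + ((sin (2 * pi * w))\<^sup>2 + (cos (2 * pi * w))\<^sup>2)
        - 2 * (cos (2 * pi * u) * cos (2 * pi * w) + sin (2 * pi * u) * sin (2 * pi * w)))"
    by algebra
  also have "\<dots> = r\<^sup>2 * (2 - 2 * cos (2 * (pi * (u - w))))"
    by (simp only: sin_cos_squared_add cos_diff[symmetric]) (simp add: algebra_simps)
  also have "\<dots> = (2 * r * sin (pi * (u - w)))\<^sup>2"
    unfolding cos_double_sin by (simp add: power2_eq_square algebra_simps)
  finally have *: "(r * cos (2 * pi * u) - r * cos (2 * pi * w))\<^sup>2
      + (r * sin (2 * pi * u) - r * sin (2 * pi * w))\<^sup>2 = (2 * r * sin (pi * (u - w)))\<^sup>2" .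
  have "dist (circle_point l u) (circle_point l w) = \<bar>2 * r * sin (pi * (u - w))\<bar>"
    unfolding circle_point_def r_def[symmetric] dist_norm norm_eq_sqrt_inner inner_vec_def
    using * by (simp add: sum_2 power2_eq_square[symmetric])
  also have "\<dots> = l / pi * \<bar>sin (pi * (u - w))\<bar>"
    using assms by (simp add: abs_mult r_def)
  finally show ?thesis .
qed

lemma circle_point_in_round_circle:
  assumes "l > 0"
  shows "circle_point l u \<in> round_circle l"
proof -
  define r where "r = l / (2 * pi)"
  have r: "r > 0" using assms by (simp add: r_def)
  have "(r * cos (2 * pi * u))\<^sup>2 + (r * sin (2 * pi * u))\<^sup>2
     = r\<^sup>2 * ((sin (2 * pi * u))\<^sup>2 + (cos (2 * pi * u))\<^sup>2)"
    by algebra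
  also have "\<dots> = r\<^sup>2" by simp
  finally have "norm (circle_point l u) = r"
    unfolding circle_point_def r_def[symmetric] norm_eq_sqrt_inner inner_vec_def
    using r by (simp add: sum_2 power2_eq_square[symmetric])
  then show ?thesis by (simp add: round_circle_def r_def)
qed

lemma round_circle_eq_image:
  assumes "l > 0"
  shows "round_circle l = circle_point l ` {0..<1}"
proof (intro equalityI subsetI)
  fix x :: "real^2" assume x: "x \<in> round_circle l"
  define r where "r = l / (2 * pi)"
  have r: "r > 0" using assms by (simp add: r_def)
  have "norm x = r" using x by (simp add: round_circle_def r_def)
  then have "(x $ 1)\<^sup>2 + (x $ 2)\<^sup>2 = r\<^sup>2"
    unfolding norm_eq_sqrt_inner inner_vec_def using r
    by (auto simp: sum_2 power2_eq_square[symmetric])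
  then have "(x $ 1 / r)\<^sup>2 + (x $ 2 / r)\<^sup>2 = 1"
    using r by (simp add: power_divide add_divide_distrib[symmetric])
  then obtain t where t: "0 \<le> t" "t < 2 * pi" "x $ 1 / r = cos t" "x $ 2 / r = sin t"
    using sincos_total_2pi by metis
  have "x = circle_point l (t / (2 * pi))"
    unfolding circle_point_def r_def[symmetric]
    using t r by (simp add: vec_eq_iff forall_2 field_simps)
  moreover have "t / (2 * pi) \<in> {0..<1}" using t by simp
  ultimately show "x \<in> circle_point l ` {0..<1}" by blast
next
  fix x assume "x \<in> circle_point l ` {0..<1}"
  then show "x \<in> round_circle l" using circle_point_in_round_circle[OF assms] by auto
qed

lemma abs_sin_pi_eq:
  assumes "\<bar>u\<bar> \<le> 1"
  shows "\<bar>sin (pi * u)\<bar> = sin (pi * \<bar>u\<bar>)"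
proof -
  have "sin (pi * \<bar>u\<bar>) \<ge> 0" using assms by (intro sin_ge_zero) auto
  then show ?thesis by (cases "u \<ge> 0") auto
qed

lemma inj_on_circle_point:
  assumes "l > 0"
  shows "inj_on (circle_point l) {0..<1}"
proof (rule inj_onI, rule ccontr)
  fix u w :: real assume u: "u \<in> {0..<1}" and w: "w \<in> {0..<1}"
    and eq: "circle_point l u = circle_point l w" and "u \<noteq> w"
  have "sin (pi * \<bar>u - w\<bar>) > 0"
    using u w \<open>u \<noteq> w\<close> by (intro sin_gt_zero) (auto simp: abs_less_iff)
  moreover have "\<bar>sin (pi * (u - w))\<bar> = sin (pi * \<bar>u - w\<bar>)"
    using u w by (intro abs_sin_pi_eq) auto
  moreover have "l / pi * \<bar>sin (pi * (u - w))\<bar> = 0"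
    using eq dist_circle_point[OF assms, of u w] by simp
  ultimately show False using assms by simp
qed

lemma positive_definite_round_circle:
  assumes "l > 0"
  shows "positive_definite_space (round_circle l)"
  unfolding positive_definite_space_def
proof (intro allI impI)
  fix W and v :: "real^2 \<Rightarrow> real"
  assume W: "finite W" "W \<subseteq> round_circle l" and v: "\<exists>x\<in>W. v x \<noteq> 0"
  obtain A where A: "A \<subseteq> {0..<1}" "W = circle_point l ` A"
    using W(2) unfolding round_circle_eq_image[OF assms] by (auto simp: subset_image_iff)
  have inj: "inj_on (circle_point l) A"
    using inj_on_circle_point[OF assms] A(1) by (rule inj_on_subset)
  have fin: "finite A" using W(1) A(2) inj by (simp add: finite_image_iff)
  have "dist (circle_point l x) (circle_point l y) = l / pi * sin (pi * \<bar>x - y\<bar>)"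
    if "x \<in> A" "y \<in> A" for x y
  proof -
    have "0 \<le> x" "x < 1" "0 \<le> y" "y < 1" using that A(1) by auto
    then show ?thesis
      by (subst dist_circle_point[OF assms], subst abs_sin_pi_eq) auto
  qed
  then have "(\<Sum>x\<in>W. \<Sum>y\<in>W. v x * exp (- dist x y) * v y)
      = (\<Sum>x\<in>A. \<Sum>y\<in>A. v (circle_point l x) * exp (- (l / pi) * sin (pi * \<bar>x - y\<bar>))
          * v (circle_point l y))"
    unfolding A(2) by (simp add: sum.reindex[OF inj])
  also have "\<dots> > 0"
    using v A fin assms
    by (intro exp_sin_quadratic_pos[of "l / pi" A "\<lambda>x. v (circle_point l x)"]) auto
  finally show "0 < (\<Sum>x\<in>W. \<Sum>y\<in>W. v x * exp (- dist x y) * v y)" .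
qed

section \<open>Riemann sums of periodic functions\<close>

text \<open>Moving the start by \<open>1 / n\<close> permutes the nodes cyclically modulo 1, the
  last node replacing the first; iterate, and for negative \<open>i\<close> apply the result from
  the shifted start.\<close>

lemma periodic_equispaced_sum_shift:
  fixes g :: "real \<Rightarrow> real"
  assumes per: "\<And>x. g (x + 1) = g x" and n: "n > 0"
  shows "(\<Sum>j<n. g (x + real_of_int i / real n + real j / real n)) = (\<Sum>j<n. g (x + real j / real n))"
proof -
  have step: "(\<Sum>j<n. g (x + 1 / real n + real j / real n)) = (\<Sum>j<n. g (x + real j / real n))" for x
  proof -
    have "(\<Sum>j<n. g (x + 1 / real n + real j / real n)) + g x
        = (\<Sum>j<Suc n. g (x + real j / real n))"
      by (subst sum.lessThan_Suc_shift) (simp add: add_divide_distrib add_ac)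
    also have "\<dots> = (\<Sum>j<n. g (x + real j / real n)) + g x"
      using n per by simp
    finally show ?thesis by simp
  qed
  have nat: "(\<Sum>j<n. g (x + real i / real n + real j / real n)) = (\<Sum>j<n. g (x + real j / real n))"
    for i :: nat and x
  proof (induction i)
    case (Suc i)
    show ?case
      using Suc step[of "x + real i / real n"] by (simp add: add_divide_distrib add_ac)
  qed simp
  show ?thesis
  proof (cases "i \<ge> 0")
    case True
    then show ?thesis using nat[of x "nat i"] by simp
  next
    case False
    then show ?thesis using nat[of "x + real_of_int i / real n" "nat (- i)"] by simp
  qed
qed

lemma integral_Icc_split_equispaced:
  fixes g :: "real \<Rightarrow> real"
  assumes cont: "continuous_on UNIV g"
  shows "integral {0..real m / real n} g = (\<Sum>j<m. integral {real j / real n..real (Suc j) / real n} g)"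
proof (induction m)
  case (Suc m)
  have "integral {0..real m / real n} g + integral {real m / real n..real (Suc m) / real n} g
      = integral {0..real (Suc m) / real n} g"
    by (intro Henstock_Kurzweil_Integration.integral_combine integrable_continuous_real
        continuous_on_subset[OF cont]) (auto simp: divide_right_mono)
  then show ?case using Suc by simp
qed simp

text \<open>A shift by a multiple of \<open>1 / n\<close> brings the start into the first cell, so
  each node lies in the closed cell of its index and uniform continuity controls the error cell by
  cell.\<close>

lemma periodic_riemann_sum_tendsto:
  fixes g :: "real \<Rightarrow> real"
  assumes cont: "continuous_on UNIV g" and per: "\<And>x. g (x + 1) = g x"
  shows "(\<lambda>n. (\<Sum>j<n. g (x + real j / real n)) / real n) \<longlonglongrightarrow> integral {0..1} g"
proof (rule LIMSEQ_I)
  fix e :: real assume e: "e > 0"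
  have "uniformly_continuous_on {0..2} g"
    by (intro compact_uniformly_continuous continuous_on_subset[OF cont]) auto
  then obtain d where d: "d > 0"
    and dd: "\<And>s t. s \<in> {0..2} \<Longrightarrow> t \<in> {0..2} \<Longrightarrow> dist t s < d \<Longrightarrow> dist (g t) (g s) < e / 2"
    unfolding uniformly_continuous_on_def using e by (metis half_gt_zero)
  obtain N :: nat where N: "N > 0" "1 / real N < d"
    using real_arch_inverse[of d] d by (auto simp: inverse_eq_divide)
  have "norm ((\<Sum>j<n. g (x + real j / real n)) / real n - integral {0..1} g) < e" if "n \<ge> N" for n
  proof -
    have n: "n > 0" using that N by simp
    have "1 / real n \<le> 1 / real N" using that N by (intro divide_left_mono) auto
    then have nd: "1 / real n < d" using N(2) by linarith
    \<comment> \<open>With this shift, \<open>y * n\<close> is the fractional part of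
      \<open>x * n\<close>.\<close>
    define i where "i = - \<lfloor>x * real n\<rfloor>"
    define y where "y = x + real_of_int i / real n"
    have "y * real n = x * real n - real_of_int \<lfloor>x * real n\<rfloor>"
      using n by (simp add: y_def i_def field_simps)
    then have "0 \<le> y * real n" "y * real n \<le> 1" by linarith+
    then have y: "0 \<le> y" "y \<le> 1 / real n"
      using n by (auto simp: field_simps zero_le_mult_iff)
    have piece: "\<bar>g (y + real j / real n) / real n
        - integral {real j / real n..real (Suc j) / real n} g\<bar> \<le> e / 2 * (1 / real n)" if "j < n" for j
    proof -
      let ?a = "real j / real n" and ?b = "real (Suc j) / real n"
      have ab: "?b = ?a + 1 / real n" by (simp add: add_divide_distrib)
      have b1: "?a \<ge> 0" "?b \<le> 1" "1 / real n \<le> 1" using that n by auto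
      have int: "(g has_integral integral {?a..?b} g) {?a..?b}"
        by (intro integrable_integral integrable_continuous_real continuous_on_subset[OF cont]) auto
      have "((\<lambda>s. g (y + ?a) - g s) has_integral
          g (y + ?a) * (1 / real n) - integral {?a..?b} g) {?a..?b}"
        using has_integral_diff[OF has_integral_const_real[of "g (y + ?a)" ?a ?b] int] ab
        by (simp add: mult.commute)
      then have "norm (g (y + ?a) * (1 / real n) - integral {?a..?b} g)
          \<le> e / 2 * Henstock_Kurzweil_Integration.content (cbox ?a ?b)"
      proof (intro has_integral_bound[of "e / 2"])
        show "norm (g (y + ?a) - g s) \<le> e / 2" if "s \<in> cbox ?a ?b" for s
        proof -
          have "dist (g (y + ?a)) (g s) < e / 2"
          proof (rule dd)
            have s: "?a \<le> s" "s \<le> ?b" using that by auto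
            show "s \<in> {0..2}" using s b1 unfolding atLeastAtMost_iff by linarith
            show "y + ?a \<in> {0..2}" using y b1 ab by simp
            show "dist (y + ?a) s < d" using s y ab nd by (simp add: dist_real_def)
          qed
          then show ?thesis by (simp add: dist_norm)
        qed
      qed (use e in auto)
      then show ?thesis using ab by simp
    qed
    have "(\<Sum>j<n. g (x + real j / real n)) = (\<Sum>j<n. g (y + real j / real n))"
      unfolding y_def by (rule periodic_equispaced_sum_shift[where g = g, OF per n, symmetric])
    moreover have "integral {0..1} g = (\<Sum>j<n. integral {real j / real n..real (Suc j) / real n} g)"
      using integral_Icc_split_equispaced[OF cont, of n n] n by simp
    ultimately have "\<bar>(\<Sum>j<n. g (x + real j / real n)) / real n - integral {0..1} g\<bar>
      = \<bar>\<Sum>j<n. g (y + real j / real n) / real n - integral {real j / real n..real (Suc j) / real n} g\<bar>"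
      by (simp add: sum_subtractf sum_divide_distrib)
    also have "\<dots> \<le> (\<Sum>j<n. e / 2 * (1 / real n))"
      by (rule order_trans[OF sum_abs]) (intro sum_mono piece, simp)
    also have "\<dots> = e / 2" using n by simp
    finally show ?thesis using e by simp
  qed
  then show "\<exists>no. \<forall>n\<ge>no. norm ((\<Sum>j<n. g (x + real j / real n)) / real n - integral {0..1} g) < e"
    by blast
qed

section \<open>The magnitude of the circle\<close>

text \<open>The absolute value extends the integrand from the unit interval to an even function of
  period 1 on the whole line.\<close>

definition chord_kernel :: "real \<Rightarrow> real \<Rightarrow> real" where
  "chord_kernel l u = exp (- (l / pi * \<bar>sin (pi * u)\<bar>))"

lemma chord_kernel_pos: "chord_kernel l u > 0"
  by (simp add: chord_kernel_def)

lemma chord_kernel_periodic: "chord_kernel l (u + 1) = chord_kernel l u"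
  by (simp add: chord_kernel_def distrib_left)

lemma chord_kernel_minus: "chord_kernel l (- u) = chord_kernel l u"
  by (simp add: chord_kernel_def)

lemma continuous_on_chord_kernel: "continuous_on UNIV (chord_kernel l)"
  unfolding chord_kernel_def by (intro continuous_intros)

lemma exp_dist_circle_point:
  assumes "l > 0"
  shows "exp (- dist (circle_point l u) (circle_point l w)) = chord_kernel l (w - u)"
  using dist_circle_point[OF assms, of u w] chord_kernel_minus[of l "w - u"]
  by (simp add: chord_kernel_def)

section \<open>Regular polygons and the limit of their magnitudes\<close>

definition regular_polygon :: "real \<Rightarrow> nat \<Rightarrow> (real^2) set" where
  "regular_polygon l n = (\<lambda>j. circle_point l (real j / real n)) ` {..<n}"

lemma regular_polygon_subset: "l > 0 \<Longrightarrow> regular_polygon l n \<subseteq> round_circle l"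
  by (auto simp: regular_polygon_def circle_point_in_round_circle)

lemma finite_regular_polygon: "finite (regular_polygon l n)"
  by (simp add: regular_polygon_def)

lemma sum_regular_polygon:
  assumes "l > 0"
  shows "(\<Sum>x\<in>regular_polygon l n. f x) = (\<Sum>j<n. f (circle_point l (real j / real n)))"
proof -
  have "inj_on (\<lambda>j. circle_point l (real j / real n)) {..<n}"
  proof (rule inj_onI)
    fix i j assume ij: "i \<in> {..<n}" "j \<in> {..<n}"
      and "circle_point l (real i / real n) = circle_point l (real j / real n)"
    then have "real i / real n = real j / real n"
      by (intro inj_onD[OF inj_on_circle_point[OF assms]]) auto
    then show "i = j" using ij by simp
  qed
  then show ?thesis unfolding regular_polygon_def by (simp add: sum.reindex)
qed

definition polygon_sum :: "real \<Rightarrow> nat \<Rightarrow> real" where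
  "polygon_sum l n = (\<Sum>j<n. chord_kernel l (real j / real n))"

lemma polygon_sum_pos: "n > 0 \<Longrightarrow> polygon_sum l n > 0"
  unfolding polygon_sum_def by (intro sum_pos) (auto simp: chord_kernel_pos lessThan_empty_iff)

text \<open>The kernel matrix of the polygon is circulant, so every row sums to
  \<open>polygon_sum l n\<close>.\<close>

lemma weighting_regular_polygon:
  assumes "l > 0" "n > 0"
  shows "weighting (regular_polygon l n) (\<lambda>_. 1 / polygon_sum l n)"
  unfolding weighting_def
proof
  fix x assume "x \<in> regular_polygon l n"
  then obtain k where x: "x = circle_point l (real k / real n)"
    unfolding regular_polygon_def by auto
  have "(\<Sum>y\<in>regular_polygon l n. exp (- dist x y))
      = (\<Sum>j<n. chord_kernel l (0 + real_of_int (- int k) / real n + real j / real n))"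
    unfolding x sum_regular_polygon[OF assms(1)] exp_dist_circle_point[OF assms(1)] by simp
  also have "\<dots> = polygon_sum l n"
    unfolding polygon_sum_def
    using periodic_equispaced_sum_shift[where g = "chord_kernel l", OF chord_kernel_periodic assms(2), of 0 "- int k"] by simp
  finally show "(\<Sum>y\<in>regular_polygon l n. exp (- dist x y) * (1 / polygon_sum l n)) = 1"
    using polygon_sum_pos[OF assms(2), of l]
    by (simp add: sum_distrib_right[symmetric] sum_divide_distrib[symmetric])
qed

lemma finite_magnitude_regular_polygon:
  assumes "l > 0" "n > 0"
  shows "finite_magnitude (regular_polygon l n) = real n / polygon_sum l n"
  using finite_magnitude_eq[OF weighting_regular_polygon[OF assms]]
  by (simp add: sum_regular_polygon[OF assms(1)] del: sum_constant) simp

lemma integral_chord_kernel_pos: "integral {0..1} (chord_kernel l) > 0"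
proof -
  have cont: "continuous_on (cbox 0 1) (chord_kernel l)"
    by (rule continuous_on_subset[OF continuous_on_chord_kernel]) simp
  have int: "(chord_kernel l has_integral integral {0..1} (chord_kernel l)) (cbox 0 1)"
    using integrable_integral[OF integrable_continuous[OF cont]] by simp
  then have "integral {0..1} (chord_kernel l) \<ge> 0"
    by (rule has_integral_nonneg) (simp add: chord_kernel_pos less_imp_le)
  moreover have "integral {0..1} (chord_kernel l) \<noteq> 0"
  proof
    assume "integral {0..1} (chord_kernel l) = 0"
    then have "chord_kernel l 0 = 0"
      using has_integral_0_cbox_imp_0[OF cont, of 0] int by (auto simp: chord_kernel_pos less_imp_le)
    then show False using chord_kernel_pos[of l 0] by simp
  qed
  ultimately show ?thesis by linarith
qed

lemma polygon_sum_div_tendsto: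
  "(\<lambda>n. polygon_sum l n / real n) \<longlonglongrightarrow> integral {0..1} (chord_kernel l)"
  using periodic_riemann_sum_tendsto[OF continuous_on_chord_kernel chord_kernel_periodic, of l 0]
  by (simp add: polygon_sum_def)

lemma finite_magnitude_regular_polygon_tendsto:
  assumes "l > 0"
  shows "(\<lambda>n. finite_magnitude (regular_polygon l n)) \<longlonglongrightarrow> inverse (integral {0..1} (chord_kernel l))"
proof -
  have "(\<lambda>n. inverse (polygon_sum l n / real n)) \<longlonglongrightarrow> inverse (integral {0..1} (chord_kernel l))"
    using polygon_sum_div_tendsto integral_chord_kernel_pos[of l] by (intro tendsto_inverse) auto
  then show ?thesis
    by (rule Lim_transform_eventually)
      (auto simp: finite_magnitude_regular_polygon[OF assms] intro!: eventually_sequentiallyI[of 1])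
qed

text \<open>The pairing of \<open>w\<close> with the polygon weighting is a sum over
  \<open>W\<close> of \<open>w x\<close> times a quotient of Riemann sums, started at
  \<open>- \<theta> x\<close> and at 0. Both tend to \<open>I\<close>, so the limit reads
  \<open>2 * m \<le> m + inverse I\<close>.\<close>

lemma finite_magnitude_le_circle:
  assumes l: "l > 0" and W: "finite W" "W \<subseteq> round_circle l"
  shows "finite_magnitude W \<le> inverse (integral {0..1} (chord_kernel l))"
proof -
  define I where "I = integral {0..1} (chord_kernel l)"
  have I: "I > 0" unfolding I_def by (rule integral_chord_kernel_pos)
  note pd = positive_definite_round_circle[OF l]
  obtain w where w: "weighting W w"
    using positive_definite_space_weighting[OF pd W] .
  define m where "m = (\<Sum>x\<in>W. w x)"
  define \<theta> where "\<theta> = inv_into {0..<1} (circle_point l)"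
  have \<theta>: "x = circle_point l (\<theta> x)" if "x \<in> W" for x
    using that W(2) unfolding round_circle_eq_image[OF l] \<theta>_def by (metis f_inv_into_f subsetD)
  define R where "R = (\<lambda>n x. (\<Sum>j<n. chord_kernel l (- \<theta> x + real j / real n)) / real n)"
  \<comment> \<open>On a weighting the quadratic form equals the total weight, which turns both
    diagonal terms of the comparison into magnitudes.\<close>
  have self: "(\<Sum>x\<in>V. \<Sum>y\<in>V. u x * exp (- dist x y) * u y) = (\<Sum>x\<in>V. u x)"
    if "weighting V u" for V :: "(real^2) set" and u
  proof -
    have "(\<Sum>x\<in>V. \<Sum>y\<in>V. u x * exp (- dist x y) * u y)
      = (\<Sum>x\<in>V. u x * (\<Sum>y\<in>V. exp (- dist x y) * u y))"
      by (simp only: sum_distrib_left mult.assoc)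
    also have "\<dots> = (\<Sum>x\<in>V. u x)"
      using that by (intro sum.cong) (auto simp: weighting_def)
    finally show ?thesis .
  qed
  have le: "2 * (\<Sum>x\<in>W. w x * (R n x / (polygon_sum l n / real n)))
      \<le> m + finite_magnitude (regular_polygon l n)" if n: "n > 0" for n
  proof -
    define c where "c = 1 / polygon_sum l n"
    have cw: "weighting (regular_polygon l n) (\<lambda>_. c)"
      unfolding c_def by (rule weighting_regular_polygon[OF l n])
    have "(\<Sum>y\<in>regular_polygon l n. w x * exp (- dist x y) * c)
        = w x * (R n x / (polygon_sum l n / real n))" if "x \<in> W" for x
    proof -
      have "(\<Sum>y\<in>regular_polygon l n. exp (- dist x y)) = real n * R n x"
        by (subst \<theta>[OF that], unfold sum_regular_polygon[OF l] exp_dist_circle_point[OF l])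
          (use n in \<open>simp add: R_def\<close>)
      then have "w x * (\<Sum>y\<in>regular_polygon l n. exp (- dist x y)) * c
          = w x * (R n x / (polygon_sum l n / real n))"
        by (simp add: c_def)
      then show ?thesis
        by (simp add: sum_distrib_left sum_distrib_right)
    qed
    then have "2 * (\<Sum>x\<in>W. w x * (R n x / (polygon_sum l n / real n)))
      = 2 * (\<Sum>x\<in>W. \<Sum>y\<in>regular_polygon l n. w x * exp (- dist x y) * c)" by simp
    also have "\<dots> \<le> m + finite_magnitude (regular_polygon l n)"
      using positive_definite_space_cross_le[OF pd W finite_regular_polygon[of l n]
          regular_polygon_subset[OF l], of w "\<lambda>_. c"] self[OF cw]
      unfolding self[OF w] finite_magnitude_eq[OF cw] m_def by simp
    finally show ?thesis .
  qed
  have R: "(\<lambda>n. R n x) \<longlonglongrightarrow> I" for x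
    unfolding R_def I_def
    by (rule periodic_riemann_sum_tendsto[OF continuous_on_chord_kernel chord_kernel_periodic])
  have "(\<lambda>n. 2 * (\<Sum>x\<in>W. w x * (R n x / (polygon_sum l n / real n))))
      \<longlonglongrightarrow> 2 * (\<Sum>x\<in>W. w x * (I / I))"
    using polygon_sum_div_tendsto[of l] I
    by (intro tendsto_intros R) (auto simp: I_def)
  moreover have "(\<lambda>n. m + finite_magnitude (regular_polygon l n)) \<longlonglongrightarrow> m + inverse I"
    unfolding I_def by (intro tendsto_intros finite_magnitude_regular_polygon_tendsto l)
  ultimately have "2 * (\<Sum>x\<in>W. w x * (I / I)) \<le> m + inverse I"
    by (rule LIMSEQ_le) (intro exI[of _ 1] allI impI le, simp)
  then show ?thesis
    using I finite_magnitude_eq[OF w] by (simp add: m_def I_def)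
qed

theorem theorem12:
  fixes l :: real
  assumes "l > 0"
  shows "magnitude (round_circle l) =
    ereal (inverse (integral {0..1} (\<lambda>s::real. exp (- (l / pi) * sin (pi * s)))))"
proof -
  let ?I = "integral {0..1} (chord_kernel l)"
  have "compact (round_circle l)" by (simp add: round_circle_def)
  then have "magnitude (round_circle l)
      = (SUP W\<in>{W. finite W \<and> W \<subseteq> round_circle l}. ereal (finite_magnitude W))"
    using positive_definite_round_circle[OF assms] by (simp add: magnitude_def)
  also have "\<dots> = ereal (inverse ?I)"
  proof (rule antisym)
    show "(SUP W\<in>{W. finite W \<and> W \<subseteq> round_circle l}. ereal (finite_magnitude W)) \<le> ereal (inverse ?I)"
      by (rule SUP_least) (simp add: finite_magnitude_le_circle[OF assms])
    \<comment> \<open>Every polygon competes in the supremum, including the empty one at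
      \<open>n = 0\<close>, so the limit of their magnitudes is a lower bound.\<close>
    have "(\<lambda>n. ereal (finite_magnitude (regular_polygon l n))) \<longlonglongrightarrow> ereal (inverse ?I)"
      using finite_magnitude_regular_polygon_tendsto[OF assms] by simp
    then show "ereal (inverse ?I) \<le> (SUP W\<in>{W. finite W \<and> W \<subseteq> round_circle l}. ereal (finite_magnitude W))"
      by (rule LIMSEQ_le_const2)
        (intro exI[of _ 0] allI impI SUP_upper, simp add: finite_regular_polygon regular_polygon_subset[OF assms])
  qed
  \<comment> \<open>The sine is nonnegative over this range, so the absolute value
    disappears.\<close>
  also have "?I = integral {0..1} (\<lambda>s. exp (- (l / pi) * sin (pi * s)))"
    by (intro integral_cong) (auto simp: chord_kernel_def abs_sin_pi_eq)
  finally show ?thesis .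
qed

end
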